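(* Let $X$ be a nonzero real Banach space, and let $x \in B_X$ be a LUR point. Then $dc(x) = 1-\|x\|$.
   Context: $B_X$, $S_X$, $X^*$ denote the closed unit ball, unit sphere and topological dual of $X$. A point $x\in B_X$ is a LUR (locally uniformly rotund) point if $\|x_n-x\|\to 0$ whenever a sequence $(x_n)\subseteq X$ with $\|x_n\|\to\|x\|$ satisfies $\|x_n+x\|\to 2\|x\|$. A slice of $B_X$ is a set $S(x^*,\delta)=\{y\in B_X : x^*(y)>1-\delta\}$ with $x^*\in S_{X^*}$ and $\delta>0$. For $x\in B_X$, the Daugavet constant $dc(x)$ is the supremum of all $\alpha\ge 0$ such that for all $\varepsilon,\delta>0$ and all $y^*\in S_{X^*}$ there exists $y\in S(y^*,\delta)$ with $\|y-x\|>\alpha-\varepsilon$. *)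

theory Defs
  imports "HOL-Analysis.Analysis"
begin

definition LUR_point :: "'a::real_normed_vector \<Rightarrow> bool" where
  "LUR_point x \<longleftrightarrow>
    x \<in> cball 0 1 \<and>
    (\<forall>u :: nat \<Rightarrow> 'a.
      (\<lambda>n. norm (u n)) \<longlonglongrightarrow> norm x \<and> (\<lambda>n. norm (u n + x)) \<longlonglongrightarrow> 2 * norm x
      \<longrightarrow> (\<lambda>n. norm (u n - x)) \<longlonglongrightarrow> 0)"

definition slice :: "('a::real_normed_vector \<Rightarrow>\<^sub>L real) \<Rightarrow> real \<Rightarrow> 'a set" where
  "slice f \<delta> = {y \<in> cball 0 1. blinfun_apply f y > 1 - \<delta>}"

text \<open>
  The dual unit sphere is the set of bounded linear functionals of operator norm 1. For
  \<open>x\<close> in the unit ball of a nonzero space, the set below contains \<open>0\<close> and is bounded above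
  by \<open>2\<close>, so the real supremum is the genuine one.
\<close>

definition daugavet_const :: "'a::real_normed_vector \<Rightarrow> real" where
  "daugavet_const x =
    Sup {\<alpha>. \<alpha> \<ge> 0 \<and>
      (\<forall>\<epsilon>>0. \<forall>\<delta>>0. \<forall>f \<in> sphere (0 :: 'a \<Rightarrow>\<^sub>L real) 1.
        \<exists>y \<in> slice f \<delta>. norm (y - x) > \<alpha> - \<epsilon>)}"

end

theory Submission imports Defs begin

text \<open>
  A functional \<open>f\<close> of norm one with \<open>f x = \<parallel>x\<parallel>\<close> (Hahn--Banach) defines slices whose elements
  \<open>y\<close>, once rescaled to \<open>\<parallel>x\<parallel> y\<close>, are nearly aligned with \<open>x\<close>; local uniform rotundity then
  forces \<open>\<parallel>x\<parallel> y\<close> to be close to \<open>x\<close>, so \<open>\<parallel>y - x\<parallel>\<close> is at most about \<open>1 - \<parallel>x\<parallel>\<close>. Conversely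
  every slice contains points of norm close to one, which are at distance about
  \<open>1 - \<parallel>x\<parallel>\<close> or more from \<open>x\<close>. For Hahn--Banach, Zorn's lemma gives a minimal sublinear
  functional below a given one, and minimality forces linearity.
\<close>

section \<open>Sublinear functionals and Hahn-Banach\<close>

definition sublinear :: "('a::real_vector \<Rightarrow> real) \<Rightarrow> bool" where
  "sublinear p \<longleftrightarrow> (\<forall>x y. p (x + y) \<le> p x + p y) \<and> (\<forall>c\<ge>0. \<forall>x. p (c *\<^sub>R x) \<le> c * p x)"

lemma sublinearI:
  assumes "\<And>x y. p (x + y) \<le> p x + p y" "\<And>c x. c \<ge> 0 \<Longrightarrow> p (c *\<^sub>R x) \<le> c * p x"
  shows "sublinear p"
  using assms by (simp add: sublinear_def)

lemma sublinear_add: "sublinear p \<Longrightarrow> p (x + y) \<le> p x + p y"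
  by (simp add: sublinear_def)

lemma sublinear_scaleR_le: "sublinear p \<Longrightarrow> c \<ge> 0 \<Longrightarrow> p (c *\<^sub>R x) \<le> c * p x"
  by (simp add: sublinear_def)

lemma sublinear_zero:
  assumes "sublinear p" shows "p 0 = 0"
  using sublinear_scaleR_le[OF assms, of 0 0] sublinear_add[OF assms, of 0 0] by simp

text \<open>For \<open>c > 0\<close>, applying the inequality with factor \<open>inverse c\<close>
  to \<open>c *\<^sub>R x\<close> gives the reverse one. So the definition can ask only for
  \<open>\<le>\<close>, which is easier to check for infima.\<close>

lemma sublinear_scaleR:
  assumes "sublinear p" "c \<ge> 0"
  shows "p (c *\<^sub>R x) = c * p x"
proof (cases "c = 0")
  case True
  then show ?thesis using sublinear_zero[OF assms(1)] by simp
next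
  case False
  then have "c > 0" using assms(2) by simp
  have "p (inverse c *\<^sub>R (c *\<^sub>R x)) \<le> inverse c * p (c *\<^sub>R x)"
    using \<open>c > 0\<close> by (intro sublinear_scaleR_le[OF assms(1)]) simp
  then have "c * p x \<le> p (c *\<^sub>R x)"
    using \<open>c > 0\<close> by (simp add: field_simps)
  then show ?thesis using sublinear_scaleR_le[OF assms] by (simp add: antisym)
qed

lemma sublinear_ge_minus:
  assumes "sublinear p" shows "- p (- x) \<le> p x"
  using sublinear_add[OF assms, of x "- x"] sublinear_zero[OF assms] by simp

text \<open>\<open>q\<close> pushes \<open>p\<close> down along \<open>- a\<close>:
  \<open>t = 0\<close> gives \<open>q \<le> p\<close>, and \<open>t = 1\<close> gives
  \<open>q (- a) \<le> - p a\<close>. The infimum is finite because subadditivity bounds every term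
  below by \<open>- p (- x)\<close>.\<close>

lemma sublinear_directional:
  fixes a :: "'a::real_vector"
  assumes p: "sublinear p"
  defines "q \<equiv> \<lambda>x. INF t\<in>{0..}. p (x + t *\<^sub>R a) - t * p a"
  shows "sublinear q" and "\<And>t x. t \<ge> 0 \<Longrightarrow> q x \<le> p (x + t *\<^sub>R a) - t * p a"
proof -
  have bdd: "bdd_below ((\<lambda>t. p (x + t *\<^sub>R a) - t * p a) ` {0..})" for x
  proof (rule bdd_belowI2)
    fix t :: real assume t: "t \<in> {0..}"
    have "p (t *\<^sub>R a) \<le> p (x + t *\<^sub>R a) + p (- x)"
      using sublinear_add[OF p, of "x + t *\<^sub>R a" "- x"] by simp
    then show "- p (- x) \<le> p (x + t *\<^sub>R a) - t * p a"
      using sublinear_scaleR[OF p, of t a] t by simp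
  qed
  show le: "q x \<le> p (x + t *\<^sub>R a) - t * p a" if "t \<ge> 0" for t x
    unfolding q_def using that by (intro cINF_lower[OF bdd]) auto
  have ge: "b \<le> q x" if "\<And>t. t \<ge> 0 \<Longrightarrow> b \<le> p (x + t *\<^sub>R a) - t * p a" for b x
    unfolding q_def using that by (intro cINF_greatest) auto
  show "sublinear q"
  proof (rule sublinearI)
    fix x y
    \<comment> \<open>The sum of the terms with parameters \<open>s\<close> and \<open>t\<close>
      dominates the term for \<open>x + y\<close> with parameter \<open>s + t\<close>. The infima
      are then taken one at a time, first over \<open>t\<close> with \<open>s\<close> fixed, then
      over \<open>s\<close>.\<close>
    have *: "q (x + y) - (p (x + s *\<^sub>R a) - s * p a) \<le> p (y + t *\<^sub>R a) - t * p a"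
      if "s \<ge> 0" "t \<ge> 0" for s t
      using le[of "s + t" "x + y"] that sublinear_add[OF p, of "x + s *\<^sub>R a" "y + t *\<^sub>R a"]
      by (simp add: algebra_simps)
    have "q (x + y) - (p (x + s *\<^sub>R a) - s * p a) \<le> q y" if "s \<ge> 0" for s
      using *[OF that] by (rule ge)
    then have "q (x + y) - q y \<le> p (x + s *\<^sub>R a) - s * p a" if "s \<ge> 0" for s
      using that by (simp add: algebra_simps)
    then have "q (x + y) - q y \<le> q x"
      by (rule ge)
    then show "q (x + y) \<le> q x + q y" by simp
  next
    fix c :: real and x assume c: "c \<ge> 0"
    show "q (c *\<^sub>R x) \<le> c * q x"
    proof (cases "c = 0")
      case True
      then show ?thesis using le[of 0 0] sublinear_zero[OF p] by simp
    next
      case False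
      then have c: "c > 0" using c by simp
      have "q (c *\<^sub>R x) / c \<le> p (x + t *\<^sub>R a) - t * p a" if "t \<ge> 0" for t
      proof -
        \<comment> \<open>The parameter \<open>c * t\<close> lets the factor \<open>c\<close> be
          pulled out of the whole argument of \<open>p\<close>.\<close>
        have "q (c *\<^sub>R x) \<le> p (c *\<^sub>R (x + t *\<^sub>R a)) - c * t * p a"
          using le[of "c * t" "c *\<^sub>R x"] c that by (simp add: algebra_simps)
        then show ?thesis
          using sublinear_scaleR[OF p, of c "x + t *\<^sub>R a"] c by (simp add: field_simps)
      qed
      then have "q (c *\<^sub>R x) / c \<le> q x"
        by (rule ge)
      then show ?thesis using c by (simp add: field_simps)
    qed
  qed
qed

text \<open>Minimality forces the directional infimum \<open>q\<close> to coincide with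
  \<open>p\<close>; its bound at \<open>t = 1\<close> is then the missing superadditivity.\<close>

lemma minimal_sublinear_linear:
  assumes p: "sublinear p" and min: "\<And>q. sublinear q \<Longrightarrow> q \<le> p \<Longrightarrow> q = p"
  shows "linear p"
proof -
  have add: "p (x + a) = p x + p a" for x a
  proof (rule antisym)
    define q where "q = (\<lambda>x. INF t\<in>{0..}. p (x + t *\<^sub>R a) - t * p a)"
    have q: "sublinear q" "\<And>t x. t \<ge> 0 \<Longrightarrow> q x \<le> p (x + t *\<^sub>R a) - t * p a"
      unfolding q_def using sublinear_directional[OF p] by auto
    have "q = p"
      using q(2)[of 0] by (intro min q(1)) (simp add: le_fun_def)
    then show "p x + p a \<le> p (x + a)" using q(2)[of 1 x] by simp
  qed (rule sublinear_add[OF p])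
  have minus: "p (- x) = - p x" for x
    using add[of x "- x"] sublinear_zero[OF p] by simp
  have "p (c *\<^sub>R x) = c * p x" for c x
  proof (cases "c \<ge> 0")
    case False
    then show ?thesis using sublinear_scaleR[OF p, of "- c" x] minus[of "c *\<^sub>R x"] by simp
  qed (rule sublinear_scaleR[OF p])
  then show ?thesis using add by (intro linearI) auto
qed

text \<open>This supplies the lower bounds of chains for Zorn's lemma. The common majorant
  \<open>p\<close> keeps the infimum finite, since \<open>g x\<close> is at least
  \<open>- g (- x)\<close>, hence at least \<open>- p (- x)\<close>.\<close>

lemma sublinear_INF_chain:
  assumes "C \<noteq> {}" and sub: "\<And>g. g \<in> C \<Longrightarrow> sublinear g" and le: "\<And>g. g \<in> C \<Longrightarrow> g \<le> p"
    and chain: "\<And>g h. g \<in> C \<Longrightarrow> h \<in> C \<Longrightarrow> g \<le> h \<or> h \<le> g"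
  defines "q \<equiv> \<lambda>x. INF g\<in>C. g x"
  shows "sublinear q" and "\<And>g. g \<in> C \<Longrightarrow> q \<le> g"
proof -
  have bdd: "bdd_below ((\<lambda>g. g x) ` C)" for x
  proof (rule bdd_belowI2)
    fix g assume "g \<in> C"
    then show "- p (- x) \<le> g x"
      using sublinear_ge_minus[OF sub, of g x] le_funD[OF le, of g "- x"] by simp
  qed
  have low: "q x \<le> g x" if "g \<in> C" for g x
    unfolding q_def using that by (intro cINF_lower[OF bdd])
  then show "q \<le> g" if "g \<in> C" for g using that by (simp add: le_fun_def)
  have ge: "b \<le> q x" if "\<And>g. g \<in> C \<Longrightarrow> b \<le> g x" for b x
    unfolding q_def using that by (intro cINF_greatest[OF \<open>C \<noteq> {}\<close>])
  show "sublinear q"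
  proof (rule sublinearI)
    fix x y
    have *: "q (x + y) - g x \<le> h y" if g: "g \<in> C" and h: "h \<in> C" for g h
    proof -
      \<comment> \<open>Subadditivity needs one functional below both \<open>g\<close> and
        \<open>h\<close>; in a chain the smaller of the two serves.\<close>
      obtain k where "k \<in> C" "k \<le> g" "k \<le> h" using chain[OF g h] g h by blast
      then show ?thesis
        using low[of k "x + y"] sublinear_add[OF sub, of k x y] le_funD[of k g x] le_funD[of k h y]
        by simp
    qed
    have "q (x + y) - g x \<le> q y" if "g \<in> C" for g
      using *[OF that] by (rule ge)
    then have "q (x + y) - q y \<le> g x" if "g \<in> C" for g
      using that by (simp add: algebra_simps)
    then have "q (x + y) - q y \<le> q x"
      by (rule ge)
    then show "q (x + y) \<le> q x + q y" by simp
  next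
    fix c :: real and x assume c: "c \<ge> 0"
    have *: "q (c *\<^sub>R x) \<le> c * g x" if "g \<in> C" for g
      using low[OF that, of "c *\<^sub>R x"] sublinear_scaleR[OF sub[OF that] c, of x] by simp
    show "q (c *\<^sub>R x) \<le> c * q x"
    proof (cases "c = 0")
      case True
      then show ?thesis using * \<open>C \<noteq> {}\<close> by auto
    next
      case False
      then have c: "c > 0" using c by simp
      then have "q (c *\<^sub>R x) / c \<le> q x"
        using * by (intro ge) (simp add: field_simps)
      then show ?thesis using c by (simp add: field_simps)
    qed
  qed
qed

lemma sublinear_dominates_linear:
  assumes p: "sublinear p"
  obtains f where "linear f" "f \<le> p"
proof -
  define A where "A = {g. sublinear g \<and> g \<le> p}"
  have "\<exists>m\<in>A. \<forall>g\<in>A. g \<le> m \<longrightarrow> g = m"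
  proof (rule predicate_Zorn)
    \<comment> \<open>The order is reversed, so that the maximal element given by Zorn's lemma is a
      minimal functional.\<close>
    show "partial_order_on A (relation_of (\<lambda>g h. h \<le> g) A)"
      by (intro partial_order_on_relation_ofI) auto
    fix C assume C: "C \<in> Chains (relation_of (\<lambda>g h. h \<le> g) A)"
    then have CA: "C \<subseteq> A" by (auto simp: Chains_def relation_of_def)
    show "\<exists>u\<in>A. \<forall>a\<in>C. u \<le> a"
    proof (cases "C = {}")
      case True
      then show ?thesis using p by (auto simp: A_def)
    next
      case False
      have "g \<le> h \<or> h \<le> g" if "g \<in> C" "h \<in> C" for g h
        using C that by (auto simp: Chains_def relation_of_def)
      note inf = sublinear_INF_chain[of C p, OF False _ _ this]
      have *: "sublinear (\<lambda>x. INF g\<in>C. g x)" "\<And>g. g \<in> C \<Longrightarrow> (\<lambda>x. INF g\<in>C. g x) \<le> g"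
        using inf CA unfolding A_def by auto
      moreover obtain g where "g \<in> C" using False by auto
      ultimately have "(\<lambda>x. INF g\<in>C. g x) \<in> A"
        using CA order_trans[OF *(2)[of g], of p] by (auto simp: A_def)
      then show ?thesis using *(2) by blast
    qed
  qed
  then obtain m where m: "sublinear m" "m \<le> p" and min: "\<And>g. g \<in> A \<Longrightarrow> g \<le> m \<Longrightarrow> g = m"
    unfolding A_def by blast
  have "linear m"
    using m(2) by (intro minimal_sublinear_linear m(1) min) (auto simp: A_def)
  then show thesis using m(2) by (rule that)
qed

text \<open>Instead of extending a functional from the line through \<open>x\<close>, the norm is
  first lowered along \<open>- x\<close>. A linear \<open>g\<close> below the resulting
  \<open>q\<close> satisfies \<open>g (- x) \<le> - norm x\<close>, while
  \<open>q \<le> norm\<close> bounds \<open>g\<close> everywhere, so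
  \<open>g x = norm x\<close>.\<close>

lemma exists_norming_functional:
  fixes x :: "'a::real_normed_vector"
  assumes "x \<noteq> 0"
  obtains f :: "'a \<Rightarrow>\<^sub>L real" where "norm f = 1" "blinfun_apply f x = norm x"
proof -
  have p: "sublinear (norm :: 'a \<Rightarrow> real)"
    by (rule sublinearI) (auto intro: norm_triangle_ineq)
  define q where "q = (\<lambda>z. INF t\<in>{0..}. norm (z + t *\<^sub>R x) - t * norm x)"
  have q: "sublinear q" "\<And>t z. t \<ge> 0 \<Longrightarrow> q z \<le> norm (z + t *\<^sub>R x) - t * norm x"
    unfolding q_def using sublinear_directional[OF p] by auto
  obtain g where g: "linear g" "g \<le> q" using sublinear_dominates_linear[OF q(1)] by blast
  have le: "g z \<le> norm z" for z
    using le_funD[OF g(2), of z] q(2)[of 0 z] by simp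
  have "g (- x) \<le> - norm x"
    using le_funD[OF g(2), of "- x"] q(2)[of 1 "- x"] by simp
  then have gx: "g x = norm x" using le[of x] linear_neg[OF g(1), of x] by simp
  have abs: "\<bar>g z\<bar> \<le> norm z" for z
    using le[of z] le[of "- z"] linear_neg[OF g(1), of z] by simp
  then have bl: "bounded_linear g"
    using g(1) by (intro bounded_linear_intro[where K = 1])
      (auto simp: linear_add linear_scale)
  define f where "f = Blinfun g"
  have f: "blinfun_apply f = g" by (simp add: f_def bounded_linear_Blinfun_apply[OF bl])
  have "norm f \<le> 1" using abs by (intro norm_blinfun_bound) (auto simp: f)
  moreover have "norm x \<le> norm f * norm x"
    using norm_blinfun[of f x] gx by (simp add: f)
  ultimately have "norm f = 1" using assms by simp
  then show thesis using that f gx by simp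
qed

section \<open>Slices and local uniform rotundity\<close>

lemma slice_nonempty:
  assumes f: "norm f = 1" and "\<delta> > 0"
  shows "slice f \<delta> \<noteq> {}"
proof
  assume empty: "slice f \<delta> = {}"
  have bound: "blinfun_apply f y \<le> 1 - \<delta>" if "norm y \<le> 1" for y
    using empty that by (auto simp: slice_def not_less)
  have "0 \<le> 1 - \<delta>" using bound[of 0] by (simp add: blinfun.zero_right)
  \<comment> \<open>The ball is symmetric, so the one-sided bound on \<open>f\<close> also bounds
    its absolute value; this contradicts \<open>norm f = 1\<close>.\<close>
  have "norm f \<le> 1 - \<delta>"
  proof (rule norm_blinfun_bound[OF \<open>0 \<le> 1 - \<delta>\<close>])
    fix z
    show "norm (blinfun_apply f z) \<le> (1 - \<delta>) * norm z"
    proof (cases "z = 0")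
      case False
      have "blinfun_apply f (sgn z) \<le> 1 - \<delta>" "blinfun_apply f (- sgn z) \<le> 1 - \<delta>"
        by (rule bound, simp add: norm_sgn)+
      then show ?thesis using False
        by (simp add: sgn_div_norm blinfun.scaleR_right blinfun.minus_right field_simps abs_le_iff)
    qed (simp add: blinfun.zero_right)
  qed
  then show False using assms by simp
qed

lemma norm_gt_if_in_slice:
  assumes "norm f = 1" "y \<in> slice f \<delta>"
  shows "norm y > 1 - \<delta>"
  using assms norm_blinfun[of f y] by (auto simp: slice_def)

text \<open>The norms of \<open>y n\<close> tend to 1, so scaling by \<open>norm x\<close> gives
  norms tending to \<open>norm x\<close>, as \<open>LUR_point\<close> requires. Evaluating
  \<open>f\<close> bounds the norm of the sum with \<open>x\<close> from below, and the triangle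
  inequality from above, both with limit \<open>2 * norm x\<close>.\<close>

lemma LUR_slice_bound:
  fixes x :: "'a::real_normed_vector"
  assumes LUR: "LUR_point x" and f: "norm f = 1" and fx: "blinfun_apply f x = norm x"
    and y: "\<And>n. y n \<in> slice f (inverse (Suc n))"
  shows "(\<lambda>n. norm (norm x *\<^sub>R y n - x)) \<longlonglongrightarrow> 0"
proof -
  have y1: "norm (y n) \<le> 1" and fy: "blinfun_apply f (y n) > 1 - inverse (Suc n)" for n
    using y[of n] by (auto simp: slice_def)
  have lim: "(\<lambda>n. 1 - inverse (real (Suc n))) \<longlonglongrightarrow> 1"
    using tendsto_diff[OF tendsto_const LIMSEQ_inverse_real_of_nat, of 1] by simp
  have "(\<lambda>n. norm (y n)) \<longlonglongrightarrow> 1"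
    by (rule tendsto_sandwich[OF _ _ lim tendsto_const])
      (intro always_eventually allI y1 less_imp_le norm_gt_if_in_slice[OF f y])+
  then have 1: "(\<lambda>n. norm (norm x *\<^sub>R y n)) \<longlonglongrightarrow> norm x"
    using tendsto_mult_left[of "\<lambda>n. norm (y n)" 1 sequentially "norm x"] by simp
  have 2: "(\<lambda>n. norm (norm x *\<^sub>R y n + x)) \<longlonglongrightarrow> 2 * norm x"
  proof (rule tendsto_sandwich[OF _ _ _ tendsto_const])
    show "(\<lambda>n. norm x * (1 - inverse (real (Suc n))) + norm x) \<longlonglongrightarrow> 2 * norm x"
      using tendsto_add[OF tendsto_mult_left[OF lim, of "norm x"] tendsto_const[of "norm x"]]
      by simp
    have "norm x * (1 - inverse (real (Suc n))) + norm x \<le> norm (norm x *\<^sub>R y n + x)" for n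
    proof -
      have "norm x * (1 - inverse (real (Suc n))) + norm x
          \<le> blinfun_apply f (norm x *\<^sub>R y n + x)"
        using mult_left_mono[OF less_imp_le[OF fy[of n]], of "norm x"]
        by (simp add: blinfun.add_right blinfun.scaleR_right fx)
      also have "\<dots> \<le> norm (norm x *\<^sub>R y n + x)"
        using norm_blinfun[of f "norm x *\<^sub>R y n + x"] f by simp
      finally show ?thesis .
    qed
    then show "\<forall>\<^sub>F n in sequentially.
        norm x * (1 - inverse (real (Suc n))) + norm x \<le> norm (norm x *\<^sub>R y n + x)"
      by simp
    have "norm (norm x *\<^sub>R y n + x) \<le> 2 * norm x" for n
      using norm_triangle_ineq[of "norm x *\<^sub>R y n" x] mult_left_mono[OF y1[of n], of "norm x"]
      by simp
    then show "\<forall>\<^sub>F n in sequentially. norm (norm x *\<^sub>R y n + x) \<le> 2 * norm x"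
      by simp
  qed
  show ?thesis
    using LUR[unfolded LUR_point_def, THEN conjunct2, rule_format, OF conjI, OF 1 2] .
qed

section \<open>The Daugavet constant at a LUR point\<close>

theorem proposition2p10:
  fixes x :: "'a::banach"
  assumes nonzero: "\<exists>z::'a. z \<noteq> 0"
    and ball: "x \<in> cball 0 1"
    and LUR: "LUR_point x"
  shows "daugavet_const x = 1 - norm x"
  unfolding daugavet_const_def
proof (rule cSup_eq_maximum)
  have "\<exists>y \<in> slice f \<delta>. norm (y - x) > 1 - norm x - \<epsilon>"
    if "\<epsilon> > 0" "\<delta> > 0" "norm f = 1" for \<epsilon> \<delta> and f :: "'a \<Rightarrow>\<^sub>L real"
  proof -
    \<comment> \<open>The width \<open>min \<delta> \<epsilon>\<close> keeps \<open>y\<close> in the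
      given slice and also forces \<open>norm y > 1 - \<epsilon>\<close>.\<close>
    have "slice f (min \<delta> \<epsilon>) \<noteq> {}"
      using that by (intro slice_nonempty) auto
    then obtain y where y: "y \<in> slice f (min \<delta> \<epsilon>)" by blast
    then have "norm y > 1 - \<epsilon>"
      using norm_gt_if_in_slice[OF \<open>norm f = 1\<close> y] by linarith
    then have "norm (y - x) > 1 - norm x - \<epsilon>"
      using norm_triangle_ineq2[of y x] by linarith
    moreover have "y \<in> slice f \<delta>" using y by (auto simp: slice_def)
    ultimately show ?thesis by blast
  qed
  then show "1 - norm x \<in> {\<alpha>. \<alpha> \<ge> 0 \<and> (\<forall>\<epsilon>>0. \<forall>\<delta>>0. \<forall>f \<in> sphere (0 :: 'a \<Rightarrow>\<^sub>L real) 1.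
      \<exists>y \<in> slice f \<delta>. norm (y - x) > \<alpha> - \<epsilon>)}"
    using ball by simp
next
  fix \<alpha>
  assume "\<alpha> \<in> {\<alpha>. \<alpha> \<ge> 0 \<and> (\<forall>\<epsilon>>0. \<forall>\<delta>>0. \<forall>f \<in> sphere (0 :: 'a \<Rightarrow>\<^sub>L real) 1.
      \<exists>y \<in> slice f \<delta>. norm (y - x) > \<alpha> - \<epsilon>)}"
  then have \<alpha>: "\<exists>y \<in> slice f \<delta>. norm (y - x) > \<alpha> - \<epsilon>"
    if "\<epsilon> > 0" "\<delta> > 0" "norm f = 1" for \<epsilon> \<delta> and f :: "'a \<Rightarrow>\<^sub>L real"
    using that by simp
  obtain f :: "'a \<Rightarrow>\<^sub>L real" where f: "norm f = 1" "blinfun_apply f x = norm x"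
  \<comment> \<open>At \<open>x = 0\<close> any functional of norm one will do;
    \<open>nonzero\<close> guarantees that one exists.\<close>
  proof (cases "x = 0")
    case True
    obtain z :: 'a where "z \<noteq> 0" using nonzero by blast
    then obtain f :: "'a \<Rightarrow>\<^sub>L real" where "norm f = 1" using exists_norming_functional by blast
    then show thesis using that True by (simp add: blinfun.zero_right)
  qed (rule exists_norming_functional, assumption, rule that)
  \<comment> \<open>Taking the slice width and the error both equal to
    \<open>inverse (Suc n)\<close> yields one sequence to which the rotundity lemma applies.\<close>
  have "\<exists>y \<in> slice f (inverse (Suc n)). norm (y - x) > \<alpha> - inverse (Suc n)" for n
    using f(1) by (intro \<alpha>) auto
  then obtain y where y: "\<And>n. y n \<in> slice f (inverse (Suc n))"
      "\<And>n. norm (y n - x) > \<alpha> - inverse (Suc n)"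
    by metis
  have "\<alpha> \<le> inverse (Suc n) + norm (norm x *\<^sub>R y n - x) + (1 - norm x)" for n
  proof -
    \<comment> \<open>The first summand vanishes in the limit by rotundity; the second has norm at
      most \<open>1 - norm x\<close>.\<close>
    have "y n - x = (norm x *\<^sub>R y n - x) + (1 - norm x) *\<^sub>R y n"
      by (simp add: algebra_simps)
    then have "norm (y n - x) \<le> norm (norm x *\<^sub>R y n - x) + norm ((1 - norm x) *\<^sub>R y n)"
      by (metis norm_triangle_ineq)
    moreover have "norm ((1 - norm x) *\<^sub>R y n) \<le> 1 - norm x"
      using y(1)[of n] ball by (auto simp: slice_def intro: mult_left_le)
    ultimately show ?thesis using y(2)[of n] by linarith
  qed
  moreover have "(\<lambda>n. inverse (real (Suc n)) + norm (norm x *\<^sub>R y n - x) + (1 - norm x))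
      \<longlonglongrightarrow> 0 + 0 + (1 - norm x)"
    by (intro tendsto_add tendsto_const LIMSEQ_inverse_real_of_nat LUR_slice_bound[OF LUR f y(1)])
  ultimately show "\<alpha> \<le> 1 - norm x"
    using LIMSEQ_le_const by fastforce
qed

end
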